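(* Let $T$ be a rooted tree and $\lambda$ any eigenvalue of $L(T)$. Then $$|\mathrm{mul}_T(\lambda)-\mathrm{mul}_{T-v}(\lambda)|\le 1$$ holds for all leaves $v$ of $T$.
   Context: A rooted tree is a finite tree with a distinguished vertex (the root). The level $l(v)$ of a vertex $v$ is its distance from the root. For a rooted tree $T$ with vertices $v_1,\dots,v_n$, the level matrix $L(T)=(l_{ij})$ is the $n\times n$ real symmetric matrix with $l_{ij}=|l(v_i)-l(v_j)|$. A leaf is a pendant vertex of $T$ (a non-root vertex of degree $1$). For a leaf $v$, $T-v$ denotes the rooted tree obtained from $T$ by deleting $v$ (with the same root). $\mathrm{mul}_T(\lambda)$ denotes the multiplicity of $\lambda$ as an eigenvalue of $L(T)$ (equal to $0$ if $\lambda$ is not an eigenvalue). *)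

theory Defs
  imports
    "Graph_Theory.Graph_Theory"
    "Jordan_Normal_Form.Char_Poly"
begin

text \<open>
  Undirected graphs are the symmetric digraphs of the locale \<^locale>\<open>graph\<close> (finite, no loops,
  no parallel arcs). The library predicates \<open>forest\<close> and \<open>tree\<close> cannot be used here: they
  forbid every directed cycle, in particular going back and forth along a single edge.
  In a graph, the directed cycles with at least three arcs are exactly the undirected cycles.
\<close>

locale rooted_tree = graph T for T :: "('a, 'b) pre_digraph" +
  fixes r :: 'a
  assumes root_in_verts: "r \<in> verts T"
    and connected: "Digraph_Component.connected T"
    and acyclic: "\<not> (\<exists>p. cycle p \<and> 3 \<le> length p)"

definition level :: "('a, 'b) pre_digraph \<Rightarrow> 'a \<Rightarrow> 'a \<Rightarrow> nat" where
  "level T r v = (LEAST n. \<exists>p. pre_digraph.awalk T r p v \<and> length p = n)"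

text \<open>Every edge at a vertex contributes one outgoing (and one ingoing) arc, so the degree in the
  undirected sense is the out-degree.\<close>

definition is_leaf :: "('a, 'b) pre_digraph \<Rightarrow> 'a \<Rightarrow> 'a \<Rightarrow> bool" where
  "is_leaf T r v \<longleftrightarrow> v \<in> verts T \<and> v \<noteq> r \<and> out_degree T v = 1"

definition enumerates_verts :: "'a list \<Rightarrow> ('a, 'b) pre_digraph \<Rightarrow> bool" where
  "enumerates_verts vs T \<longleftrightarrow> distinct vs \<and> set vs = verts T"

definition level_matrix :: "('a, 'b) pre_digraph \<Rightarrow> 'a \<Rightarrow> 'a list \<Rightarrow> real mat" where
  "level_matrix T r vs = mat (length vs) (length vs)
     (\<lambda>(i, j). \<bar>real (level T r (vs ! i)) - real (level T r (vs ! j))\<bar>)"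

text \<open>Level matrices are real symmetric, so the multiplicity of an eigenvalue is its order as a root
  of the characteristic polynomial.\<close>

definition mult_level :: "('a, 'b) pre_digraph \<Rightarrow> 'a \<Rightarrow> 'a list \<Rightarrow> real \<Rightarrow> nat" where
  "mult_level T r vs x = order x (char_poly (level_matrix T r vs))"

lemma level_matrix_carrier: "level_matrix T r vs \<in> carrier_mat (length vs) (length vs)"
  by (simp add: level_matrix_def)

lemma mult_level_eq_0_iff: "mult_level T r vs x = 0 \<longleftrightarrow> \<not> eigenvalue (level_matrix T r vs) x"
proof -
  have "char_poly (level_matrix T r vs) \<noteq> 0"
    using degree_monic_char_poly[OF level_matrix_carrier[of T r vs]] by auto
  then show ?thesis
    by (simp add: mult_level_def eigenvalue_root_char_poly[OF level_matrix_carrier] order_root)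
qed

end

theory Submission
  imports Defs
begin

text \<open>
  Only two features of level matrices matter: they are real symmetric, and deleting a leaf \<open>v\<close>
  deletes one row and the corresponding column. The second holds because a walk from the root that
  visits \<open>v\<close> on its way to another vertex has to leave \<open>v\<close> the way it came; cutting out such
  detours shows that no other level changes (\<open>level_del_leaf\<close>). What remains is the bound for
  principal submatrices that is usually read off from Cauchy interlacing
  (\<open>order_char_poly_mat_delete\<close>). It is derived here without the spectral theorem.

  Let \<open>A\<close> be real symmetric, \<open>p\<close> its characteristic polynomial, \<open>q\<close> that of the principal
  submatrix without index \<open>j\<close>, and \<open>w\<close> the \<open>j\<close>-th column of the adjugate of \<open>t I - A\<close>, a vector
  of polynomials in \<open>t\<close>. Then \<open>(t I - A) w = p e\<^sub>j\<close> and \<open>w\<^sub>j = q\<close>. Differentiating the first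
  equation and pairing it with \<open>w\<close> gives, by symmetry of \<open>A\<close>,
  \<open>\<Sum>\<^sub>i w\<^sub>i\<^sup>2 = p' q - p q'\<close> (\<open>sum_squares_eq_wronskian\<close>). This is the polynomial form of the fact
  that \<open>q / p\<close>, a diagonal entry of the resolvent, is decreasing on the real line between its poles.

  Let \<open>a\<close> and \<open>b\<close> be the orders of \<open>p\<close> and \<open>q\<close> at \<open>x\<close>. The right-hand side vanishes at \<open>x\<close> to
  order at least \<open>a + b - 1\<close>, and squares of real polynomials cannot cancel, so every \<open>w\<^sub>i\<close> is
  divisible by \<open>(t - x)\<^sup>m\<close> as soon as \<open>2 m \<le> a + b\<close> (\<open>linear_power_dvd_of_sum_squares\<close>). If
  \<open>a \<ge> b + 2\<close>, then \<open>m = b + 1\<close> contradicts \<open>w\<^sub>j = q\<close>. If \<open>b \<ge> a + 2\<close>, then \<open>m = a + 1\<close> makes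
  every entry of \<open>(t I - A) w\<close> divisible by \<open>(t - x)\<^bsup>a + 1\<^esup>\<close>, but one of these entries is \<open>p\<close>.
\<close>

section \<open>Divisibility by powers of a linear factor\<close>

lemma linear_power_dvd_pderiv:
  fixes p :: "'a :: idom poly"
  assumes "[:-x, 1:] ^ n dvd p"
  shows "[:-x, 1:] ^ (n - 1) dvd pderiv p"
proof (cases n)
  case (Suc m)
  obtain c where c: "p = [:-x, 1:] ^ Suc m * c"
    using assms Suc by (blast elim: dvdE)
  have "pderiv p = [:-x, 1:] ^ m * ([:-x, 1:] * pderiv c + Polynomial.smult (of_nat (Suc m)) (pderiv [:-x, 1:]) * c)"
    unfolding c pderiv_mult pderiv_power_Suc by (simp add: algebra_simps)
  then show ?thesis
    using Suc by (metis diff_Suc_1 dvd_triv_left)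
qed simp

lemma linear_power_dvd_wronskian:
  fixes p q :: "'a :: idom poly"
  assumes p: "[:-x, 1:] ^ n dvd p" and q: "[:-x, 1:] ^ m dvd q"
  shows "[:-x, 1:] ^ (n + m - 1) dvd pderiv p * q - p * pderiv q"
proof (rule dvd_diff)
  have "[:-x, 1:] ^ (n - 1 + m) dvd pderiv p * q"
    unfolding power_add by (intro mult_dvd_mono linear_power_dvd_pderiv p q)
  then show "[:-x, 1:] ^ (n + m - 1) dvd pderiv p * q"
    by (rule power_le_dvd) simp
  have "[:-x, 1:] ^ (n + (m - 1)) dvd p * pderiv q"
    unfolding power_add by (intro mult_dvd_mono linear_power_dvd_pderiv p q)
  then show "[:-x, 1:] ^ (n + m - 1) dvd p * pderiv q"
    by (rule power_le_dvd) simp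
qed

text \<open>
  A sum of real squares that vanishes at \<open>x\<close> has all its summands vanishing there, so a linear
  factor can be split off each \<open>w i\<close>, which lowers the order of the sum by two. Unless
  the sum is zero, its order is thus even, and the odd exponent \<open>2 * m - 1\<close> already forces the exponent \<open>2 * m\<close>.
\<close>

lemma linear_power_dvd_of_sum_squares:
  fixes w :: "'i \<Rightarrow> real poly"
  assumes "finite I" and "[:-x, 1:] ^ (2 * m - 1) dvd (\<Sum>i\<in>I. (w i)\<^sup>2)" and "i \<in> I"
  shows "[:-x, 1:] ^ m dvd w i"
  using assms(2,3)
proof (induction m arbitrary: w i)
  case (Suc m)
  let ?l = "[:-x, 1:]"
  have "?l dvd (\<Sum>i\<in>I. (w i)\<^sup>2)"
    using power_le_dvd[OF Suc.prems(1), of 1] by simp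
  then have "(\<Sum>i\<in>I. (poly (w i) x)\<^sup>2) = 0"
    by (simp add: dvd_iff_poly_eq_0 poly_sum)
  then have "\<forall>i\<in>I. poly (w i) x = 0"
    using \<open>finite I\<close> by (simp add: sum_nonneg_eq_0_iff)
  then have "\<forall>i\<in>I. \<exists>u. w i = ?l * u"
    by (simp add: poly_eq_0_iff_dvd dvd_def)
  then obtain u where u: "w i = ?l * u i" if "i \<in> I" for i
    by metis
  have sum: "(\<Sum>i\<in>I. (w i)\<^sup>2) = ?l\<^sup>2 * (\<Sum>i\<in>I. (u i)\<^sup>2)"
    unfolding sum_distrib_left by (intro sum.cong) (simp_all only: u power_mult_distrib)
  have "?l ^ (2 * m - 1) dvd (\<Sum>i\<in>I. (u i)\<^sup>2)"
  proof (cases m)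
    case (Suc k)
    then have "2 * Suc m - 1 = 2 + (2 * m - 1)"
      by simp
    then have "?l\<^sup>2 * ?l ^ (2 * m - 1) dvd ?l\<^sup>2 * (\<Sum>i\<in>I. (u i)\<^sup>2)"
      using Suc.prems(1) unfolding sum by (metis power_add)
    then show ?thesis
      by (subst (asm) dvd_mult_cancel_left) auto
  qed simp
  then have "?l ^ m dvd u i"
    using Suc.prems(2) by (rule Suc.IH)
  then show ?case
    unfolding u[OF Suc.prems(2)] power_Suc by (rule mult_dvd_mono[OF dvd_refl])
qed simp


section \<open>Real symmetric matrices\<close>

text \<open>
  In matrix notation \<open>M w = p e\<^sub>j\<close> with \<open>M\<close> symmetric and \<open>M' = I\<close>. Differentiation gives
  \<open>w + M w' = p' e\<^sub>j\<close>. Pairing with \<open>w\<close> turns the middle term into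
  \<open>w \<bullet> M w' = M w \<bullet> w' = p w\<^sub>j'\<close>.
\<close>

lemma sum_squares_eq_wronskian:
  fixes M :: "nat \<Rightarrow> nat \<Rightarrow> 'a :: idom poly"
  assumes "j < n"
    and sym: "\<And>i k. i < n \<Longrightarrow> k < n \<Longrightarrow> M i k = M k i"
    and deriv: "\<And>i k. i < n \<Longrightarrow> k < n \<Longrightarrow> pderiv (M i k) = (if i = k then 1 else 0)"
    and solves: "\<And>i. i < n \<Longrightarrow> (\<Sum>k<n. M i k * w k) = (if i = j then p else 0)"
  shows "(\<Sum>i<n. (w i)\<^sup>2) = pderiv p * w j - p * pderiv (w j)"
proof -
  have deriv_solves: "w i + (\<Sum>k<n. M i k * pderiv (w k)) = (if i = j then pderiv p else 0)"
    if i: "i < n" for i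
  proof -
    have "pderiv (\<Sum>k<n. M i k * w k) = (\<Sum>k<n. (if i = k then w k else 0) + M i k * pderiv (w k))"
      unfolding pderiv_sum by (intro sum.cong) (auto simp: pderiv_mult deriv i algebra_simps)
    also have "\<dots> = w i + (\<Sum>k<n. M i k * pderiv (w k))"
      using i by (simp add: sum.distrib)
    finally show ?thesis
      using solves[OF i] by auto
  qed
  have "(\<Sum>i<n. w i * (\<Sum>k<n. M i k * pderiv (w k))) = (\<Sum>k<n. pderiv (w k) * (\<Sum>i<n. M k i * w i))"
    unfolding sum_distrib_left
    by (subst sum.swap) (auto intro!: sum.cong simp: sym algebra_simps)
  also have "\<dots> = (\<Sum>k<n. if k = j then p * pderiv (w k) else 0)"
    by (intro sum.cong) (auto simp: solves)
  also have "\<dots> = p * pderiv (w j)"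
    using \<open>j < n\<close> by simp
  finally have *: "(\<Sum>i<n. w i * (\<Sum>k<n. M i k * pderiv (w k))) = p * pderiv (w j)" .
  have "(\<Sum>i<n. w i * (w i + (\<Sum>k<n. M i k * pderiv (w k)))) = (\<Sum>i<n. if i = j then pderiv p * w i else 0)"
    by (intro sum.cong) (auto simp: deriv_solves)
  also have "\<dots> = pderiv p * w j"
    using \<open>j < n\<close> by simp
  finally show ?thesis
    using * by (simp add: distrib_left sum.distrib power2_eq_square algebra_simps)
qed

lemma char_poly_mat_delete:
  assumes A: "A \<in> carrier_mat n n" and j: "j < n"
  shows "char_poly (mat_delete A j j) = cofactor (char_poly_matrix A) j j"
proof -
  have "char_poly_matrix (mat_delete A j j) = mat_delete (char_poly_matrix A) j j"
    using A j by (intro eq_matI) (auto simp: char_poly_matrix_def mat_delete_def)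
  then show ?thesis
    by (simp add: char_poly_def cofactor_def)
qed

text \<open>
  Symmetry gives the sum of squares, which
  bounds the order of every \<open>w i\<close> from below in terms of \<open>order x p + order x q\<close>. The
  equation \<open>w j = q\<close> and row \<open>j\<close> of the system \<open>solves\<close> bound the smallest of these orders from
  above by \<open>order x q\<close> and by \<open>order x p\<close>.
\<close>

lemma order_char_poly_mat_delete:
  fixes A :: "real mat"
  assumes A: "A \<in> carrier_mat n n" and sym: "transpose_mat A = A" and j: "j < n"
  shows "\<bar>int (order x (char_poly A)) - int (order x (char_poly (mat_delete A j j)))\<bar> \<le> 1"
proof -
  let ?l = "[:-x, 1:]"
  define M where "M = char_poly_matrix A"
  define w where "w k = cofactor M j k" for k
  define p where "p = char_poly A"
  define q where "q = char_poly (mat_delete A j j)"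
  have M: "M \<in> carrier_mat n n"
    using A by (simp add: M_def)
  have "p \<noteq> 0"
    using degree_monic_char_poly[OF A] by (auto simp: p_def)
  have "q \<noteq> 0"
    using degree_monic_char_poly[OF mat_delete_carrier[OF A], of j j] by (auto simp: q_def)
  have wj: "w j = q"
    by (simp add: w_def q_def M_def char_poly_mat_delete[OF A j])
  have solves: "(\<Sum>k<n. M $$ (i, k) * w k) = (if i = j then p else 0)" if i: "i < n" for i
  proof -
    have "(\<Sum>k<n. M $$ (i, k) * w k) = (M * adj_mat M) $$ (i, j)"
      using M i j by (auto simp: times_mat_def scalar_prod_def adj_mat_def w_def intro!: sum.cong)
    also have "\<dots> = (if i = j then p else 0)"
      unfolding adj_mat(2)[OF M] using i j by (simp add: p_def char_poly_def M_def)
    finally show ?thesis .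
  qed
  have A_sym: "A $$ (i, k) = A $$ (k, i)" if "i < n" "k < n" for i k
    using that A by (subst sym[symmetric]) auto
  have wronskian: "(\<Sum>i<n. (w i)\<^sup>2) = pderiv p * q - p * pderiv q"
    unfolding wj[symmetric] using j
  proof (rule sum_squares_eq_wronskian[where M = "\<lambda>i k. M $$ (i, k)"])
    show "M $$ (i, k) = M $$ (k, i)" if "i < n" "k < n" for i k
      using that A A_sym[OF that] by (auto simp: M_def char_poly_matrix_def)
    show "pderiv (M $$ (i, k)) = (if i = k then 1 else 0)" if "i < n" "k < n" for i k
      using that A by (auto simp: M_def char_poly_matrix_def pderiv_pCons)
  qed (rule solves)
  have dvd: "?l ^ (order x p + order x q - 1) dvd (\<Sum>i<n. (w i)\<^sup>2)"
    unfolding wronskian by (intro linear_power_dvd_wronskian order_1)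
  have w_dvd: "?l ^ m dvd w i" if "2 * m \<le> order x p + order x q" "i < n" for m i
  proof (rule linear_power_dvd_of_sum_squares[where I = "{..<n}"])
    show "?l ^ (2 * m - 1) dvd (\<Sum>i<n. (w i)\<^sup>2)"
      using that(1) by (intro power_le_dvd[OF dvd]) simp
  qed (use that(2) in auto)
  have "order x p \<le> order x q + 1"
  proof (rule ccontr)
    assume "\<not> ?thesis"
    then have "?l ^ (order x q + 1) dvd q"
      using w_dvd[of "order x q + 1" j] j wj by simp
    then show False
      using \<open>q \<noteq> 0\<close> by (simp add: order_divides del: power_Suc)
  qed
  moreover have "order x q \<le> order x p + 1"
  proof (rule ccontr)
    assume "\<not> ?thesis"
    then have "?l ^ (order x p + 1) dvd (\<Sum>k<n. M $$ (j, k) * w k)"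
      by (intro dvd_sum dvd_mult w_dvd) auto
    then have "?l ^ (order x p + 1) dvd p"
      using solves[OF j] by simp
    then show False
      using \<open>p \<noteq> 0\<close> by (simp add: order_divides del: power_Suc)
  qed
  ultimately show ?thesis
    unfolding p_def q_def by linarith
qed


section \<open>Level matrices\<close>

text \<open>
  Permuting rows, transposing and permuting again multiplies the determinant twice by the sign of
  the permutation. The diagonal of \<open>t I - A\<close> is mapped to itself, so the permuted matrix is again a
  characteristic matrix.
\<close>

lemma char_poly_permute:
  fixes A :: "'a :: comm_ring_1 mat"
  assumes A: "A \<in> carrier_mat n n" and p: "p permutes {0..<n}"
  shows "char_poly (mat n n (\<lambda>(i, j). A $$ (p i, p j))) = char_poly A"
proof -
  let ?M = "char_poly_matrix A"
  define R where "R = mat n n (\<lambda>(i, j). ?M $$ (p i, j))"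
  define C where "C = mat n n (\<lambda>(i, j). transpose_mat R $$ (p i, j))"
  have M: "?M \<in> carrier_mat n n"
    using A by simp
  have p_less: "p i < n" if "i < n" for i
    using permutes_in_image[OF p, of i] that by simp
  have p_eq: "p i = p j \<longleftrightarrow> i = j" for i j
    using permutes_inj[OF p] by (auto dest: injD)
  have "char_poly_matrix (mat n n (\<lambda>(i, j). A $$ (p i, p j))) = transpose_mat C"
    using A by (intro eq_matI) (auto simp: C_def R_def char_poly_matrix_def p_less p_eq)
  then have "char_poly (mat n n (\<lambda>(i, j). A $$ (p i, p j))) = det (transpose_mat C)"
    by (simp add: char_poly_def)
  also have "\<dots> = det C"
    by (rule det_transpose[where n = n]) (simp add: C_def)
  also have "\<dots> = signof p * det (transpose_mat R)"
    unfolding C_def by (rule det_permute_rows[OF _ p]) (simp add: R_def)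
  also have "\<dots> = signof p * det R"
    by (subst det_transpose[where n = n]) (simp_all add: R_def)
  also have "\<dots> = signof p * (signof p * det ?M)"
    unfolding R_def by (simp add: det_permute_rows[OF M p])
  also have "\<dots> = char_poly A"
    by (simp add: char_poly_def sign_def)
  finally show ?thesis .
qed

text \<open>
  This allows the leaf to be listed first, so that deleting it deletes row and column \<open>0\<close>.
\<close>

lemma mult_level_cong_mset:
  assumes "mset vs = mset ws"
  shows "mult_level T r vs x = mult_level T r ws x"
proof -
  obtain p where p: "p permutes {..<length ws}" and vs: "permute_list p ws = vs"
    using mset_eq_permutation[OF assms] .
  have p_less: "p i < length ws" if "i < length ws" for i
    using permutes_in_image[OF p, of i] that by simp
  have "level_matrix T r vs =
      mat (length ws) (length ws) (\<lambda>(i, j). level_matrix T r ws $$ (p i, p j))"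
    unfolding vs[symmetric]
    by (intro eq_matI) (auto simp: level_matrix_def permute_list_nth[OF p] p_less)
  then show ?thesis
    using char_poly_permute[OF level_matrix_carrier, of p ws T r] p
    by (simp add: mult_level_def lessThan_atLeast0)
qed

text \<open>
  The arc that leads into the leaf \<open>v\<close> has a reverse, which is the only arc out of \<open>v\<close>. A walk
  through \<open>v\<close> therefore returns at once to the vertex before \<open>v\<close>, and both arcs can be dropped.
\<close>

lemma leaf_walk_shortcut:
  assumes "graph T" and "is_leaf T r v"
    and "pre_digraph.awalk T s p u" and "s \<noteq> v" and "u \<noteq> v"
  shows "\<exists>q. pre_digraph.awalk (pre_digraph.del_vert T v) s q u \<and> length q \<le> length p"
proof -
  interpret graph T by fact
  interpret H: wf_digraph "del_vert v" by (rule wf_digraph_del_vert)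
  obtain g where g: "out_arcs T v = {g}"
    using assms(2) by (auto simp: is_leaf_def out_degree_def card_1_singleton_iff)
  show ?thesis
    using assms(3,4)
  proof (induction p arbitrary: s rule: length_induct)
    case (1 p)
    have IH: "\<exists>q. H.awalk s' q u \<and> length q \<le> length p'"
      if "length p' < length p" "awalk s' p' u" "s' \<noteq> v" for s' p'
      using "1.IH" that by blast
    show ?case
    proof (cases p)
      case Nil
      then have "H.awalk s [] u"
        using 1 \<open>u \<noteq> v\<close> by (auto simp: awalk_Nil_iff H.awalk_Nil_iff verts_del_vert)
      then show ?thesis
        by auto
    next
      case (Cons e es)
      then have e: "e \<in> arcs T" "tail T e = s" and es: "awalk (head T e) es u"
        using 1 by (auto simp: awalk_Cons_iff)
      show ?thesis
      proof (cases "head T e = v")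
        case False
        then obtain q where "H.awalk (head T e) q u" "length q \<le> length es"
          using IH[OF _ es] Cons by auto
        then have "H.awalk s (e # q) u" "length (e # q) \<le> length p"
          using e False \<open>s \<noteq> v\<close> Cons by (auto simp: H.awalk_Cons_iff del_vert_simps)
        then show ?thesis
          by blast
      next
        case True
        then obtain f fs where f: "es = f # fs"
          using es \<open>u \<noteq> v\<close> by (cases es) (auto simp: awalk_Nil_iff)
        then have "f \<in> out_arcs T v" and fs: "awalk (head T f) fs u"
          using es True by (auto simp: awalk_Cons_iff)
        moreover obtain e' where "e' \<in> out_arcs T v" "head T e' = s"
        proof -
          have "(s, v) \<in> arcs_ends T"
            using e True by (auto simp: arcs_ends_def arc_to_ends_def)
          then have "(v, s) \<in> arcs_ends T"
            using sym_arcs by (auto simp: symmetric_def sym_def)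
          then show ?thesis
            using that by (auto simp: arcs_ends_def arc_to_ends_def)
        qed
        ultimately have "head T f = s"
          using g by simp
        then obtain q where "H.awalk s q u" "length q \<le> length fs"
          using IH[OF _ fs] Cons f \<open>s \<noteq> v\<close> by auto
        then show ?thesis
          using Cons f by auto
      qed
    qed
  qed
qed

lemma level_del_leaf:
  assumes "graph T" and "is_leaf T r v" and "u \<noteq> v"
  shows "level (pre_digraph.del_vert T v) r u = level T r u"
proof -
  interpret graph T by fact
  interpret H: wf_digraph "del_vert v" by (rule wf_digraph_del_vert)
  define P where "P n \<longleftrightarrow> (\<exists>p. awalk r p u \<and> length p = n)" for n
  define Q where "Q n \<longleftrightarrow> (\<exists>p. H.awalk r p u \<and> length p = n)" for n
  have "r \<noteq> v"
    using assms(2) by (auto simp: is_leaf_def)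
  have Q_P: "P n" if "Q n" for n
    using that by (auto simp: P_def Q_def intro: subgraph_awalk_imp_awalk[OF _ subgraph_del_vert[of v]])
  have P_Q: "\<exists>m\<le>n. Q m" if "P n" for n
    using that leaf_walk_shortcut[OF assms(1,2) _ \<open>r \<noteq> v\<close> \<open>u \<noteq> v\<close>] unfolding P_def Q_def by blast
  have "(LEAST n. Q n) = (LEAST n. P n)"
  proof (cases "\<exists>n. P n")
    case True
    then have P: "P (LEAST n. P n)"
      by (rule LeastI_ex)
    then obtain m where m: "m \<le> (LEAST n. P n)" "Q m"
      using P_Q by blast
    show ?thesis
    proof (rule antisym)
      show "(LEAST n. Q n) \<le> (LEAST n. P n)"
        using Least_le[of Q, OF m(2)] m(1) by (rule le_trans)
      show "(LEAST n. P n) \<le> (LEAST n. Q n)"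
        using LeastI[of Q, OF m(2)] by (intro Least_le Q_P)
    qed
  next
    case False
    then have "P = Q"
      using Q_P by blast
    then show ?thesis
      by simp
  qed
  then show ?thesis
    by (simp add: level_def P_def Q_def)
qed

theorem theorem12:
  fixes T :: "('a, 'b) pre_digraph" and r v :: 'a and vs ws :: "'a list" and x :: real
  assumes "rooted_tree T r"
    and "enumerates_verts vs T"
    and "eigenvalue (level_matrix T r vs) x"
    and "is_leaf T r v"
    and "enumerates_verts ws (pre_digraph.del_vert T v)"
  shows "\<bar>int (mult_level T r vs x) - int (mult_level (pre_digraph.del_vert T v) r ws x)\<bar> \<le> 1"
proof -
  let ?T' = "pre_digraph.del_vert T v"
  let ?A = "level_matrix T r (v # ws)"
  have graph: "graph T"
    using assms(1) by (simp add: rooted_tree_def)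
  have ws: "distinct ws" "set ws = verts T - {v}"
    using assms(5) by (auto simp: enumerates_verts_def pre_digraph.del_vert_def)
  have "mset vs = mset (v # ws)"
    using assms(2,4) ws
    by (intro set_eq_iff_mset_eq_distinct[THEN iffD1])
       (auto simp: enumerates_verts_def is_leaf_def)
  then have vs: "mult_level T r vs x = order x (char_poly ?A)"
    unfolding mult_level_def[symmetric] by (rule mult_level_cong_mset)
  have "level ?T' r (ws ! i) = level T r (ws ! i)" if "i < length ws" for i
    using nth_mem[OF that] ws by (intro level_del_leaf[OF graph assms(4)]) auto
  then have "mat_delete ?A 0 0 = level_matrix ?T' r ws"
    by (intro eq_matI) (auto simp: mat_delete_def level_matrix_def)
  moreover have "transpose_mat ?A = ?A"
    by (intro eq_matI) (auto simp: level_matrix_def abs_minus_commute)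
  ultimately show ?thesis
    using order_char_poly_mat_delete[OF level_matrix_carrier[of T r "v # ws"], of 0 x]
    unfolding vs unfolding mult_level_def by simp
qed

end
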